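(* Let $p$ be an odd prime, $m$ a positive integer, $\phi:\mathbb{Z}_p\to Sym(\mathbb{Z}_m)_0$ a group homomorphism, and let $L=\mathbb{Z}_m\rtimes_\phi\mathbb{Z}_p$ be the corresponding split metacyclic loop. If $L$ is not a group, then the nucleus $N(L)$ is a group (under the operation of $L$) and $|N(L)|=r$ for some divisor $r$ of $m$ with $r\neq m$.
   Context: $\mathbb{Z}_n$ is the cyclic group of order $n$ (additive). $Sym(\mathbb{Z}_m)_0$ is the stabilizer of $0$ in the group of all permutations of the set $\mathbb{Z}_m$; write $\phi_h=\phi(h)$. $\mathbb{Z}_m\rtimes_\phi\mathbb{Z}_p$ is the loop on $\mathbb{Z}_m\times\mathbb{Z}_p$ with operation $(a,h)(b,k)=(a+\phi_h(b),h+k)$. The nucleus is $N(L)=N_\lambda(L)\cap N_\mu(L)\cap N_\rho(L)$, where $N_\lambda(L)=\{a\in L\mid a(xy)=(ax)y\ \forall x,y\in L\}$, $N_\mu(L)=\{a\in L\mid x(ay)=(xa)y\ \forall x,y\in L\}$ and $N_\rho(L)=\{a\in L\mid x(ya)=(xy)a\ \forall x,y\in L\}$. *)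

theory Defs
  imports "HOL-Algebra.Algebra"
begin

definition sym_fixing :: "'a set \<Rightarrow> 'a \<Rightarrow> ('a \<Rightarrow> 'a) monoid" where
  "sym_fixing S x = (BijGroup S)\<lparr>carrier := stabilizer (BijGroup S) (\<lambda>g. g) x\<rparr>"

text \<open>
  The values of \<open>\<phi>\<close> need not be automorphisms of \<open>H\<close>, so in general the result is a loop
  and not a group.
\<close>

definition semidirect_loop ::
  "('a, 'c) monoid_scheme \<Rightarrow> ('b, 'd) monoid_scheme \<Rightarrow> ('b \<Rightarrow> 'a \<Rightarrow> 'a) \<Rightarrow> ('a \<times> 'b) monoid" where
  "semidirect_loop H K \<phi> =
    \<lparr>carrier = carrier H \<times> carrier K,
     monoid.mult = (\<lambda>(a, h) (b, k). (a \<otimes>\<^bsub>H\<^esub> \<phi> h b, h \<otimes>\<^bsub>K\<^esub> k)),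
     one = (\<one>\<^bsub>H\<^esub>, \<one>\<^bsub>K\<^esub>)\<rparr>"

abbreviation split_metacyclic_loop ::
  "nat \<Rightarrow> nat \<Rightarrow> (int \<Rightarrow> int \<Rightarrow> int) \<Rightarrow> (int \<times> int) monoid" where
  "split_metacyclic_loop m p \<phi> \<equiv> semidirect_loop (integer_mod_group m) (integer_mod_group p) \<phi>"

definition left_nucleus :: "('a, 'c) monoid_scheme \<Rightarrow> 'a set" where
  "left_nucleus L = {a \<in> carrier L. \<forall>x\<in>carrier L. \<forall>y\<in>carrier L.
     a \<otimes>\<^bsub>L\<^esub> (x \<otimes>\<^bsub>L\<^esub> y) = (a \<otimes>\<^bsub>L\<^esub> x) \<otimes>\<^bsub>L\<^esub> y}"

definition middle_nucleus :: "('a, 'c) monoid_scheme \<Rightarrow> 'a set" where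
  "middle_nucleus L = {a \<in> carrier L. \<forall>x\<in>carrier L. \<forall>y\<in>carrier L.
     x \<otimes>\<^bsub>L\<^esub> (a \<otimes>\<^bsub>L\<^esub> y) = (x \<otimes>\<^bsub>L\<^esub> a) \<otimes>\<^bsub>L\<^esub> y}"

definition right_nucleus :: "('a, 'c) monoid_scheme \<Rightarrow> 'a set" where
  "right_nucleus L = {a \<in> carrier L. \<forall>x\<in>carrier L. \<forall>y\<in>carrier L.
     x \<otimes>\<^bsub>L\<^esub> (y \<otimes>\<^bsub>L\<^esub> a) = (x \<otimes>\<^bsub>L\<^esub> y) \<otimes>\<^bsub>L\<^esub> a}"

definition nucleus :: "('a, 'c) monoid_scheme \<Rightarrow> 'a set" where
  "nucleus L = left_nucleus L \<inter> middle_nucleus L \<inter> right_nucleus L"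

end

theory Submission
  imports Defs
begin

text \<open>
  In \<open>L = H \<rtimes>\<^sub>\<phi> K\<close>, with \<open>H\<close> abelian and written additively here, the triple
  \<open>(a, h), (b, k), (c, l)\<close> associates if and only if
  \<open>\<phi> h (b + \<phi> k c) = \<phi> h b + \<phi> h (\<phi> k c)\<close>. This condition mentions only \<open>h\<close> of the first
  entry, only \<open>b\<close> and \<open>k\<close> of the second and only \<open>c\<close> of the third, so each of the three nuclei
  can be computed separately:
  the left one consists of the \<open>(a, h)\<close> with \<open>\<phi> h\<close> additive, while the middle and the right one
  both constrain the first coordinate alone, to the set \<open>A\<close> of those \<open>b\<close> with
  \<open>\<phi> h (b + c) = \<phi> h b + \<phi> h c\<close> for all \<open>h\<close> and \<open>c\<close>. Hence \<open>N(L) = A \<times> B\<close>, where \<open>B\<close> is the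
  set of the \<open>h\<close> with \<open>\<phi> h\<close> additive.

  Both \<open>A\<close> and \<open>B\<close> are subgroups, of \<open>H\<close> and of \<open>K\<close>. If \<open>A = H\<close> or \<open>B = K\<close>, then every \<open>\<phi> h\<close>
  is an automorphism and \<open>L\<close> is an ordinary semidirect product, that is, a group. If \<open>L\<close> is not
  a group and \<open>K\<close> has prime order, then \<open>B\<close> is therefore trivial by Lagrange's theorem, so that
  \<open>N(L)\<close> is a copy of \<open>A\<close>, a proper subgroup of \<open>H\<close>; Lagrange's theorem applied to \<open>A\<close>
  finishes the argument.
\<close>

section \<open>Actions by permutations that fix the identity\<close>

lemma sym_fixing_mult:
  assumes "f \<in> carrier (sym_fixing S s)" "g \<in> carrier (sym_fixing S s)" "x \<in> S"
  shows "(f \<otimes>\<^bsub>sym_fixing S s\<^esub> g) x = f (g x)"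
  using assms by (simp add: sym_fixing_def stabilizer_def BijGroup_def compose_def)

lemma sym_fixing_bij_betw: "f \<in> carrier (sym_fixing S s) \<Longrightarrow> bij_betw f S S"
  by (simp add: sym_fixing_def stabilizer_def BijGroup_def Bij_def)

lemma sym_fixing_fixes: "f \<in> carrier (sym_fixing S s) \<Longrightarrow> f s = s"
  by (simp add: sym_fixing_def stabilizer_def)

locale loop_action = H: comm_group H + K: group K
  for H :: "('a, 'c) monoid_scheme" and K :: "('b, 'd) monoid_scheme" +
  fixes \<phi> :: "'b \<Rightarrow> 'a \<Rightarrow> 'a"
  assumes action_hom: "\<phi> \<in> hom K (sym_fixing (carrier H) \<one>\<^bsub>H\<^esub>)"
begin

abbreviation L where "L \<equiv> semidirect_loop H K \<phi>"

definition additive_elements :: "'a set" where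
  "additive_elements = {b \<in> carrier H. \<forall>h\<in>carrier K. \<forall>c\<in>carrier H.
     \<phi> h (b \<otimes>\<^bsub>H\<^esub> c) = \<phi> h b \<otimes>\<^bsub>H\<^esub> \<phi> h c}"

definition additive_indices :: "'b set" where
  "additive_indices = {h \<in> carrier K. \<phi> h \<in> hom H H}"

lemma action_in: "h \<in> carrier K \<Longrightarrow> \<phi> h \<in> carrier (sym_fixing (carrier H) \<one>\<^bsub>H\<^esub>)"
  using action_hom by (rule hom_in_carrier)

lemma action_bij: "h \<in> carrier K \<Longrightarrow> bij_betw (\<phi> h) (carrier H) (carrier H)"
  by (rule sym_fixing_bij_betw[OF action_in])

lemma action_closed [simp]: "h \<in> carrier K \<Longrightarrow> x \<in> carrier H \<Longrightarrow> \<phi> h x \<in> carrier H"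
  using action_bij bij_betwE by blast

lemma action_fixes_one [simp]: "h \<in> carrier K \<Longrightarrow> \<phi> h \<one>\<^bsub>H\<^esub> = \<one>\<^bsub>H\<^esub>"
  by (rule sym_fixing_fixes[OF action_in])

lemma action_mult:
  assumes "h \<in> carrier K" "k \<in> carrier K" "x \<in> carrier H"
  shows "\<phi> (h \<otimes>\<^bsub>K\<^esub> k) x = \<phi> h (\<phi> k x)"
proof -
  have "\<phi> (h \<otimes>\<^bsub>K\<^esub> k) = \<phi> h \<otimes>\<^bsub>sym_fixing (carrier H) \<one>\<^bsub>H\<^esub>\<^esub> \<phi> k"
    using action_hom assms by (simp add: hom_mult)
  then show ?thesis
    using sym_fixing_mult assms action_in by metis
qed

lemma action_one [simp]:
  assumes "x \<in> carrier H"
  shows "\<phi> \<one>\<^bsub>K\<^esub> x = x"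
proof -
  have "\<phi> \<one>\<^bsub>K\<^esub> (\<phi> \<one>\<^bsub>K\<^esub> x) = \<phi> \<one>\<^bsub>K\<^esub> x"
    using action_mult[of "\<one>\<^bsub>K\<^esub>" "\<one>\<^bsub>K\<^esub>" x] assms by simp
  then show ?thesis
    using action_bij[of "\<one>\<^bsub>K\<^esub>"] assms by (auto simp: bij_betw_def dest: inj_onD)
qed

lemma action_surj:
  assumes "h \<in> carrier K" "x \<in> carrier H"
  obtains y where "y \<in> carrier H" "x = \<phi> h y"
  using action_bij[OF assms(1)] assms(2) by (auto simp: bij_betw_def)

section \<open>Associativity and the three nuclei\<close>

lemma loop_mult [simp]: "(a, h) \<otimes>\<^bsub>L\<^esub> (b, k) = (a \<otimes>\<^bsub>H\<^esub> \<phi> h b, h \<otimes>\<^bsub>K\<^esub> k)"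
  and loop_one [simp]: "\<one>\<^bsub>L\<^esub> = (\<one>\<^bsub>H\<^esub>, \<one>\<^bsub>K\<^esub>)"
  and loop_carrier [simp]: "carrier L = carrier H \<times> carrier K"
  by (simp_all add: semidirect_loop_def)

lemma loop_assoc_iff:
  assumes "a \<in> carrier H" "b \<in> carrier H" "c \<in> carrier H"
    and "h \<in> carrier K" "k \<in> carrier K" "l \<in> carrier K"
  shows "(a, h) \<otimes>\<^bsub>L\<^esub> ((b, k) \<otimes>\<^bsub>L\<^esub> (c, l)) = ((a, h) \<otimes>\<^bsub>L\<^esub> (b, k)) \<otimes>\<^bsub>L\<^esub> (c, l)
    \<longleftrightarrow> \<phi> h (b \<otimes>\<^bsub>H\<^esub> \<phi> k c) = \<phi> h b \<otimes>\<^bsub>H\<^esub> \<phi> h (\<phi> k c)"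
  using assms by (simp add: action_mult H.m_assoc K.m_assoc)

lemma additive_elementsD:
  assumes "b \<in> additive_elements" "h \<in> carrier K" "c \<in> carrier H"
  shows "\<phi> h (b \<otimes>\<^bsub>H\<^esub> c) = \<phi> h b \<otimes>\<^bsub>H\<^esub> \<phi> h c"
  using assms by (simp add: additive_elements_def)

lemma additive_elements_closed: "b \<in> additive_elements \<Longrightarrow> b \<in> carrier H"
  by (simp add: additive_elements_def)

text \<open>
  Every \<open>c\<close> in \<open>H\<close> has the form \<open>\<phi> k d\<close>, so \<open>\<phi> k b + c = \<phi> k (b + d)\<close>, and applying \<open>\<phi> h\<close> to
  this gives \<open>\<phi> (h k) (b + d)\<close>, which splits because \<open>b\<close> is additive. This invariance is what
  makes the right nucleus no smaller than the middle one: associativity with \<open>c\<close> in the last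
  position asks for additivity of every \<open>\<phi> k c\<close>, not just of \<open>c\<close>.
\<close>

lemma action_additive_elements:
  assumes b: "b \<in> additive_elements" and k: "k \<in> carrier K"
  shows "\<phi> k b \<in> additive_elements"
proof -
  have bH: "b \<in> carrier H" using b by (rule additive_elements_closed)
  have "\<phi> h (\<phi> k b \<otimes>\<^bsub>H\<^esub> c) = \<phi> h (\<phi> k b) \<otimes>\<^bsub>H\<^esub> \<phi> h c"
    if h: "h \<in> carrier K" and c: "c \<in> carrier H" for h c
  proof -
    obtain d where d: "d \<in> carrier H" "c = \<phi> k d" using action_surj[OF k c] .
    have "\<phi> h (\<phi> k b \<otimes>\<^bsub>H\<^esub> \<phi> k d) = \<phi> h (\<phi> k (b \<otimes>\<^bsub>H\<^esub> d))"
      using additive_elementsD[OF b k d(1)] by simp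
    also have "\<dots> = \<phi> (h \<otimes>\<^bsub>K\<^esub> k) (b \<otimes>\<^bsub>H\<^esub> d)"
      using h k bH d by (simp add: action_mult)
    also have "\<dots> = \<phi> (h \<otimes>\<^bsub>K\<^esub> k) b \<otimes>\<^bsub>H\<^esub> \<phi> (h \<otimes>\<^bsub>K\<^esub> k) d"
      using additive_elementsD[OF b _ d(1)] h k by simp
    finally show ?thesis using h k bH d by (simp add: action_mult)
  qed
  then show ?thesis using bH k by (simp add: additive_elements_def)
qed

lemma left_nucleus_eq: "left_nucleus L = carrier H \<times> additive_indices"
proof (intro subset_antisym subrelI)
  fix a h assume ah: "(a, h) \<in> left_nucleus L"
  then have a: "a \<in> carrier H" and h: "h \<in> carrier K" by (auto simp: left_nucleus_def)
  have "\<phi> h (b \<otimes>\<^bsub>H\<^esub> c) = \<phi> h b \<otimes>\<^bsub>H\<^esub> \<phi> h c" if bc: "b \<in> carrier H" "c \<in> carrier H" for b c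
  proof -
    have "(a, h) \<otimes>\<^bsub>L\<^esub> ((b, \<one>\<^bsub>K\<^esub>) \<otimes>\<^bsub>L\<^esub> (c, \<one>\<^bsub>K\<^esub>)) = ((a, h) \<otimes>\<^bsub>L\<^esub> (b, \<one>\<^bsub>K\<^esub>)) \<otimes>\<^bsub>L\<^esub> (c, \<one>\<^bsub>K\<^esub>)"
      using ah bc unfolding left_nucleus_def loop_carrier by blast
    then show ?thesis
      unfolding loop_assoc_iff[OF a bc h K.one_closed K.one_closed] using bc by simp
  qed
  then show "(a, h) \<in> carrier H \<times> additive_indices"
    using a h by (simp add: additive_indices_def hom_def)
next
  fix a h assume "(a, h) \<in> carrier H \<times> additive_indices"
  then show "(a, h) \<in> left_nucleus L"
    by (auto simp: left_nucleus_def additive_indices_def loop_assoc_iff hom_mult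
        simp del: loop_mult)
qed

lemma middle_nucleus_eq: "middle_nucleus L = additive_elements \<times> carrier K"
proof (intro subset_antisym subrelI)
  fix b k assume bk: "(b, k) \<in> middle_nucleus L"
  then have b: "b \<in> carrier H" and k: "k \<in> carrier K" by (auto simp: middle_nucleus_def)
  have "\<phi> h (b \<otimes>\<^bsub>H\<^esub> c) = \<phi> h b \<otimes>\<^bsub>H\<^esub> \<phi> h c" if h: "h \<in> carrier K" and c: "c \<in> carrier H" for h c
  proof -
    obtain d where d: "d \<in> carrier H" "c = \<phi> k d" using action_surj[OF k c] .
    have "(\<one>\<^bsub>H\<^esub>, h) \<otimes>\<^bsub>L\<^esub> ((b, k) \<otimes>\<^bsub>L\<^esub> (d, \<one>\<^bsub>K\<^esub>)) = ((\<one>\<^bsub>H\<^esub>, h) \<otimes>\<^bsub>L\<^esub> (b, k)) \<otimes>\<^bsub>L\<^esub> (d, \<one>\<^bsub>K\<^esub>)"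
      using bk d(1) h H.one_closed K.one_closed
      unfolding middle_nucleus_def loop_carrier by blast
    then show ?thesis
      unfolding loop_assoc_iff[OF H.one_closed b d(1) h k K.one_closed] using d by simp
  qed
  then show "(b, k) \<in> additive_elements \<times> carrier K"
    using b k by (simp add: additive_elements_def)
next
  fix b k assume "(b, k) \<in> additive_elements \<times> carrier K"
  then show "(b, k) \<in> middle_nucleus L"
    by (auto simp: middle_nucleus_def loop_assoc_iff additive_elements_closed additive_elementsD
        simp del: loop_mult)
qed

lemma right_nucleus_eq: "right_nucleus L = additive_elements \<times> carrier K"
proof (intro subset_antisym subrelI)
  fix c l assume cl: "(c, l) \<in> right_nucleus L"
  then have c: "c \<in> carrier H" and l: "l \<in> carrier K" by (auto simp: right_nucleus_def)
  have "\<phi> h (c \<otimes>\<^bsub>H\<^esub> b) = \<phi> h c \<otimes>\<^bsub>H\<^esub> \<phi> h b" if h: "h \<in> carrier K" and b: "b \<in> carrier H" for h b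
  proof -
    have "(\<one>\<^bsub>H\<^esub>, h) \<otimes>\<^bsub>L\<^esub> ((b, \<one>\<^bsub>K\<^esub>) \<otimes>\<^bsub>L\<^esub> (c, l)) = ((\<one>\<^bsub>H\<^esub>, h) \<otimes>\<^bsub>L\<^esub> (b, \<one>\<^bsub>K\<^esub>)) \<otimes>\<^bsub>L\<^esub> (c, l)"
      using cl b h H.one_closed K.one_closed
      unfolding right_nucleus_def loop_carrier by blast
    then show ?thesis
      unfolding loop_assoc_iff[OF H.one_closed b c h K.one_closed l]
      using b c h by (simp add: H.m_comm)
  qed
  then show "(c, l) \<in> additive_elements \<times> carrier K"
    using c l by (simp add: additive_elements_def)
next
  fix c l assume "(c, l) \<in> additive_elements \<times> carrier K"
  then have c: "c \<in> additive_elements" and l: "l \<in> carrier K" by auto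
  have "\<phi> h (b \<otimes>\<^bsub>H\<^esub> \<phi> k c) = \<phi> h b \<otimes>\<^bsub>H\<^esub> \<phi> h (\<phi> k c)"
    if "h \<in> carrier K" "k \<in> carrier K" "b \<in> carrier H" for h k b
    using additive_elementsD[OF action_additive_elements[OF c]] additive_elements_closed[OF c] that
    by (simp add: H.m_comm)
  then show "(c, l) \<in> right_nucleus L"
    using c l by (auto simp: right_nucleus_def loop_assoc_iff additive_elements_closed
        simp del: loop_mult)
qed

lemma nucleus_eq: "nucleus L = additive_elements \<times> additive_indices"
  unfolding nucleus_def left_nucleus_eq middle_nucleus_eq right_nucleus_eq
  by (auto simp: additive_elements_def additive_indices_def)

section \<open>The two factors of the nucleus as subgroups\<close>

lemma additive_elements_subgroup: "subgroup additive_elements H"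
proof (rule H.subgroupI)
  show "additive_elements \<subseteq> carrier H" by (auto simp: additive_elements_def)
  have "\<one>\<^bsub>H\<^esub> \<in> additive_elements" by (simp add: additive_elements_def)
  then show "additive_elements \<noteq> {}" by blast
next
  fix a assume a: "a \<in> additive_elements"
  have aH: "a \<in> carrier H" using a by (rule additive_elements_closed)
  \<comment> \<open>Cancel \<open>\<phi> h a\<close> in \<open>\<phi> h (a + (- a + c)) = \<phi> h c\<close>; taking \<open>c = 0\<close> then identifies the
    factor \<open>- \<phi> h a\<close> as \<open>\<phi> h (- a)\<close>.\<close>
  have shift: "\<phi> h (inv\<^bsub>H\<^esub> a \<otimes>\<^bsub>H\<^esub> c) = inv\<^bsub>H\<^esub> \<phi> h a \<otimes>\<^bsub>H\<^esub> \<phi> h c"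
    if h: "h \<in> carrier K" and c: "c \<in> carrier H" for h c
  proof -
    have "\<phi> h a \<otimes>\<^bsub>H\<^esub> \<phi> h (inv\<^bsub>H\<^esub> a \<otimes>\<^bsub>H\<^esub> c) = \<phi> h (a \<otimes>\<^bsub>H\<^esub> (inv\<^bsub>H\<^esub> a \<otimes>\<^bsub>H\<^esub> c))"
      using additive_elementsD[OF a h] aH c by simp
    also have "\<dots> = \<phi> h c"
      using aH c by (simp add: H.m_assoc[symmetric])
    finally show ?thesis
      using aH c h by (intro H.inv_solve_left[THEN iffD2]) auto
  qed
  have "\<phi> h (inv\<^bsub>H\<^esub> a) = inv\<^bsub>H\<^esub> \<phi> h a" if "h \<in> carrier K" for h
    using shift[OF that H.one_closed] aH that by simp
  then show "inv\<^bsub>H\<^esub> a \<in> additive_elements"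
    using shift aH by (simp add: additive_elements_def)
next
  fix a b assume a: "a \<in> additive_elements" and b: "b \<in> additive_elements"
  have "\<phi> h (a \<otimes>\<^bsub>H\<^esub> b \<otimes>\<^bsub>H\<^esub> c) = \<phi> h (a \<otimes>\<^bsub>H\<^esub> b) \<otimes>\<^bsub>H\<^esub> \<phi> h c"
    if "h \<in> carrier K" "c \<in> carrier H" for h c
    using that additive_elements_closed[OF a] additive_elements_closed[OF b]
    by (simp add: H.m_assoc additive_elementsD[OF a] additive_elementsD[OF b])
  then show "a \<otimes>\<^bsub>H\<^esub> b \<in> additive_elements"
    using additive_elements_closed[OF a] additive_elements_closed[OF b]
    by (simp add: additive_elements_def)
qed

lemma additive_indices_subgroup: "subgroup additive_indices K"
proof (rule K.subgroupI)
  show "additive_indices \<subseteq> carrier K" by (auto simp: additive_indices_def)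
  have "\<one>\<^bsub>K\<^esub> \<in> additive_indices" by (simp add: additive_indices_def hom_def)
  then show "additive_indices \<noteq> {}" by blast
next
  fix h assume "h \<in> additive_indices"
  then have h: "h \<in> carrier K" and hom: "\<phi> h \<in> hom H H" by (auto simp: additive_indices_def)
  have "\<phi> (inv\<^bsub>K\<^esub> h) (x \<otimes>\<^bsub>H\<^esub> y) = \<phi> (inv\<^bsub>K\<^esub> h) x \<otimes>\<^bsub>H\<^esub> \<phi> (inv\<^bsub>K\<^esub> h) y"
    if x: "x \<in> carrier H" and y: "y \<in> carrier H" for x y
  proof -
    have cancel: "\<phi> (inv\<^bsub>K\<^esub> h) (\<phi> h u) = u" if "u \<in> carrier H" for u
      using action_mult[of "inv\<^bsub>K\<^esub> h" h u] h that by simp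
    obtain u v where "u \<in> carrier H" "x = \<phi> h u" "v \<in> carrier H" "y = \<phi> h v"
      using action_surj[OF h x] action_surj[OF h y] by metis
    then show ?thesis
      using cancel hom_mult[OF hom, of u v] by (metis H.m_closed)
  qed
  then show "inv\<^bsub>K\<^esub> h \<in> additive_indices"
    using h by (simp add: additive_indices_def hom_def)
next
  fix h k assume "h \<in> additive_indices" "k \<in> additive_indices"
  then show "h \<otimes>\<^bsub>K\<^esub> k \<in> additive_indices"
    by (simp add: additive_indices_def hom_def action_mult)
qed

text \<open>
  Both sides say that \<open>\<phi> h (b + c) = \<phi> h b + \<phi> h c\<close> for all \<open>h\<close>, \<open>b\<close> and \<open>c\<close>, with the
  quantifiers in different order.
\<close>

lemma additive_indices_full_iff:
  "additive_indices = carrier K \<longleftrightarrow> additive_elements = carrier H"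
  by (auto simp: additive_indices_def additive_elements_def hom_def set_eq_iff)

text \<open>
  Associativity holds because the left nucleus is then all of \<open>L\<close>; inverses are those of a
  semidirect product.
\<close>

lemma group_if_additive:
  assumes "additive_indices = carrier K"
  shows "group L"
proof (rule groupI)
  show "x \<otimes>\<^bsub>L\<^esub> y \<otimes>\<^bsub>L\<^esub> z = x \<otimes>\<^bsub>L\<^esub> (y \<otimes>\<^bsub>L\<^esub> z)"
    if "x \<in> carrier L" "y \<in> carrier L" "z \<in> carrier L" for x y z
  proof -
    have "x \<in> left_nucleus L"
      using that(1) unfolding left_nucleus_eq assms loop_carrier .
    then show ?thesis using that(2,3) unfolding left_nucleus_def mem_Collect_eq by metis
  qed
  show "\<exists>y\<in>carrier L. y \<otimes>\<^bsub>L\<^esub> x = \<one>\<^bsub>L\<^esub>" if xL: "x \<in> carrier L" for x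
  proof -
    obtain a h where x: "x = (a, h)" and a: "a \<in> carrier H" and h: "h \<in> carrier K"
      using xL by auto
    have "(inv\<^bsub>H\<^esub> \<phi> (inv\<^bsub>K\<^esub> h) a, inv\<^bsub>K\<^esub> h) \<otimes>\<^bsub>L\<^esub> x = \<one>\<^bsub>L\<^esub>"
      using a h by (simp add: x)
    then show ?thesis using a h by (intro bexI) auto
  qed
qed auto

text \<open>
  Since \<open>\<phi> \<one>\<close> is the identity, \<open>L\<close> multiplies the elements over \<open>\<one>\<close> exactly as \<open>H\<close> does.
\<close>

lemma group_subgroup_times_one:
  assumes "subgroup A H"
  shows "group (L\<lparr>carrier := A \<times> {\<one>\<^bsub>K\<^esub>}\<rparr>)"
proof -
  interpret A: subgroup A H by fact
  let ?G = "L\<lparr>carrier := A \<times> {\<one>\<^bsub>K\<^esub>}\<rparr>"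
  show ?thesis
  proof (rule groupI)
    show "x \<otimes>\<^bsub>?G\<^esub> y \<otimes>\<^bsub>?G\<^esub> z = x \<otimes>\<^bsub>?G\<^esub> (y \<otimes>\<^bsub>?G\<^esub> z)"
      if "x \<in> carrier ?G" "y \<in> carrier ?G" "z \<in> carrier ?G" for x y z
      using that by (auto simp: H.m_assoc)
    show "\<exists>y\<in>carrier ?G. y \<otimes>\<^bsub>?G\<^esub> x = \<one>\<^bsub>?G\<^esub>" if "x \<in> carrier ?G" for x
      using that by (intro bexI[of _ "(inv\<^bsub>H\<^esub> fst x, \<one>\<^bsub>K\<^esub>)"]) auto
  qed auto
qed

section \<open>Acting groups of prime order\<close>

theorem nucleus_if_prime_order:
  assumes fin: "finite (carrier H)" and prime: "Factorial_Ring.prime (order K)"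
    and not_group: "\<not> group L"
  shows "group (L\<lparr>carrier := nucleus L\<rparr>)"
    and "card (nucleus L) dvd order H"
    and "card (nucleus L) \<noteq> order H"
proof -
  have finK: "finite (carrier K)"
    using prime by (metis K.order_gt_0_iff_finite prime_gt_0_nat)
  have proper: "additive_indices \<noteq> carrier K"
    using group_if_additive not_group by blast
  have sub: "additive_indices \<subseteq> carrier K"
    using additive_indices_subgroup by (rule subgroup.subset)
  have "card additive_indices dvd order K"
    using K.lagrange[OF additive_indices_subgroup] by (metis dvd_triv_right)
  moreover have "card additive_indices \<noteq> order K"
    using card_subset_eq[OF finK sub] proper by (auto simp: order_def)
  ultimately have "card additive_indices = 1"
    using prime by (auto simp: prime_nat_iff)
  then have "additive_indices = {\<one>\<^bsub>K\<^esub>}"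
    using subgroup.one_closed[OF additive_indices_subgroup] by (auto simp: card_1_singleton_iff)
  then have nuc: "nucleus L = additive_elements \<times> {\<one>\<^bsub>K\<^esub>}"
    by (simp add: nucleus_eq)
  then have card_eq: "card (nucleus L) = card additive_elements"
    by (simp add: card_cartesian_product)
  show "group (L\<lparr>carrier := nucleus L\<rparr>)"
    unfolding nuc using additive_elements_subgroup by (rule group_subgroup_times_one)
  show "card (nucleus L) dvd order H"
    unfolding card_eq using H.lagrange[OF additive_elements_subgroup] by (metis dvd_triv_right)
  have "additive_elements \<noteq> carrier H"
    using proper additive_indices_full_iff by blast
  then show "card (nucleus L) \<noteq> order H"
    unfolding card_eq
    using card_subset_eq[OF fin subgroup.subset[OF additive_elements_subgroup]]
    by (auto simp: order_def)
qed

end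

theorem corollary5p4:
  fixes p m :: nat and \<phi> :: "int \<Rightarrow> int \<Rightarrow> int" and L :: "(int \<times> int) monoid"
  assumes "Factorial_Ring.prime p" and "odd p" and "m > 0"
    and "\<phi> \<in> hom (integer_mod_group p) (sym_fixing (carrier (integer_mod_group m)) 0)"
    and "L = split_metacyclic_loop m p \<phi>"
    and "\<not> group L"
  shows "group (L\<lparr>carrier := nucleus L\<rparr>) \<and>
    (\<exists>r. r dvd m \<and> r \<noteq> m \<and> card (nucleus L) = r)"
proof -
  have order: "order (integer_mod_group n) = n" if "n > 0" for n
    using that by (simp add: order_def carrier_integer_mod_group)
  interpret loop_action "integer_mod_group m" "integer_mod_group p" \<phi>
    by (intro loop_action.intro loop_action_axioms.intro)
      (use assms(4) in \<open>simp_all add: abelian_integer_mod_group\<close>)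
  have fin: "finite (carrier (integer_mod_group m))"
    using assms(3) by (simp add: carrier_integer_mod_group)
  have prime: "Factorial_Ring.prime (order (integer_mod_group p))"
    using assms(1) by (simp add: order prime_gt_0_nat)
  show ?thesis
    using nucleus_if_prime_order[OF fin prime] assms(3,5,6) by (simp add: order)
qed

end
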